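(* Let $D$ be a loose multipartite tournament. Then: (1) each connected component of $C_{1,2}(D)$ has diameter at most two; (2) $D$ has no sinks if and only if $C_{1,2}(D)$ is connected; (3) every stable set of $C_{1,2}(D)$ intersects at most two partite sets of $D$; (4) $D$ has at most two partite sets that are not $\{1,2\}$-competing; (5) if $D$ has exactly $m$ sinks and $C_{1,2}(D)$ has at least one edge, then the domination number $\gamma(C_{1,2}(D))$ belongs to $\{m+1,m+2\}$.
   Context: All graphs and digraphs are finite and simple. For a digraph $D$, a sink is a vertex of outdegree $0$; $d_D(x,y)$ is the length of a shortest directed path from $x$ to $y$. The $(1,2)$-step competition graph $C_{1,2}(D)$ is the graph on $V(D)$ in which distinct $u,v$ are adjacent iff there is a vertex $w\notin\{u,v\}$ with either $d_{D-v}(u,w)\le 1$ and $d_{D-u}(v,w)\le 2$, or $d_{D-u}(v,w)\le 1$ and $d_{D-v}(u,w)\le 2$. A multipartite tournament is an orientation of a complete $k$-partite graph for some $k\ge3$ (with nonempty partite sets). A set of vertices is $\{1,2\}$-competing if it is a clique in $C_{1,2}(D)$. A multipartite tournament is loose if some partite set is not $\{1,2\}$-competing. The domination number $\gamma(G)$ of a graph $G$ is the minimum size of a set $S$ such that every vertex is in $S$ or adjacent to a vertex of $S$. *)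

theory Defs
  imports
    "Graph_Theory.Digraph_Component"
    "HOL-Library.Disjoint_Sets"
    "HOL-Library.Extended_Nat"
begin

text \<open>
  Digraphs are finite and simple (locale \<open>digraph\<close>). A graph is, as usual in this library, a
  symmetric digraph, so that \<open>u \<rightarrow>\<^bsub>G\<^esub> v\<close> is adjacency.
\<close>

definition sink :: "('a,'b) pre_digraph \<Rightarrow> 'a \<Rightarrow> bool" where
  "sink D v \<longleftrightarrow> v \<in> verts D \<and> out_degree D v = 0"

text \<open>The distance is \<open>\<infinity>\<close> if there is no path, as the infimum of the empty set.\<close>

definition distance :: "('a,'b) pre_digraph \<Rightarrow> 'a \<Rightarrow> 'a \<Rightarrow> enat" where
  "distance G u v = (INF p\<in>{p. pre_digraph.apath G u p v}. enat (length p))"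

definition diameter :: "('a,'b) pre_digraph \<Rightarrow> enat" where
  "diameter G = (SUP u\<in>verts G. SUP v\<in>verts G. distance G u v)"

definition connected_component :: "('a,'b) pre_digraph \<Rightarrow> ('a,'b) pre_digraph \<Rightarrow> bool" where
  "connected_component G H \<longleftrightarrow> pre_digraph.max_subgraph G connected H"

definition clique :: "('a,'b) pre_digraph \<Rightarrow> 'a set \<Rightarrow> bool" where
  "clique G S \<longleftrightarrow> S \<subseteq> verts G \<and> (\<forall>u\<in>S. \<forall>v\<in>S. u \<noteq> v \<longrightarrow> u \<rightarrow>\<^bsub>G\<^esub> v)"

definition stable_set :: "('a,'b) pre_digraph \<Rightarrow> 'a set \<Rightarrow> bool" where
  "stable_set G S \<longleftrightarrow> S \<subseteq> verts G \<and> (\<forall>u\<in>S. \<forall>v\<in>S. \<not> u \<rightarrow>\<^bsub>G\<^esub> v)"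

definition dominating_set :: "('a,'b) pre_digraph \<Rightarrow> 'a set \<Rightarrow> bool" where
  "dominating_set G S \<longleftrightarrow> S \<subseteq> verts G \<and> (\<forall>v\<in>verts G. v \<in> S \<or> (\<exists>s\<in>S. s \<rightarrow>\<^bsub>G\<^esub> v))"

definition domination_number :: "('a,'b) pre_digraph \<Rightarrow> nat" where
  "domination_number G = (LEAST n. \<exists>S. finite S \<and> dominating_set G S \<and> card S = n)"

definition competition_graph12 :: "('a,'b) pre_digraph \<Rightarrow> 'a pair_pre_digraph" where
  "competition_graph12 D =
    \<lparr> pverts = verts D,
      parcs = {(u, v). u \<in> verts D \<and> v \<in> verts D \<and> u \<noteq> v \<and>
        (\<exists>w \<in> verts D - {u, v}.
          distance (pre_digraph.del_vert D v) u w \<le> 1 \<and>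
          distance (pre_digraph.del_vert D u) v w \<le> 2 \<or>
          distance (pre_digraph.del_vert D u) v w \<le> 1 \<and>
          distance (pre_digraph.del_vert D v) u w \<le> 2)} \<rparr>"

definition complete_multipartite_graph :: "'a set set \<Rightarrow> 'a pair_pre_digraph" where
  "complete_multipartite_graph P =
    \<lparr> pverts = \<Union>P,
      parcs = {(u, v). \<exists>A\<in>P. \<exists>B\<in>P. A \<noteq> B \<and> u \<in> A \<and> v \<in> B} \<rparr>"

definition orientation_of :: "('a,'b) pre_digraph \<Rightarrow> ('a,'c) pre_digraph \<Rightarrow> bool" where
  "orientation_of D G \<longleftrightarrow> digraph D \<and> verts D = verts G \<and>
    (\<forall>u v. u \<rightarrow>\<^bsub>G\<^esub> v \<longleftrightarrow> u \<rightarrow>\<^bsub>D\<^esub> v \<or> v \<rightarrow>\<^bsub>D\<^esub> u) \<and>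
    (\<forall>u v. \<not> (u \<rightarrow>\<^bsub>D\<^esub> v \<and> v \<rightarrow>\<^bsub>D\<^esub> u))"

text \<open>\<open>P\<close> is the set of partite sets; it is uniquely determined by \<open>D\<close>.\<close>

definition multipartite_tournament :: "('a,'b) pre_digraph \<Rightarrow> 'a set set \<Rightarrow> bool" where
  "multipartite_tournament D P \<longleftrightarrow>
    partition_on (verts D) P \<and> 3 \<le> card P \<and> orientation_of D (complete_multipartite_graph P)"

definition competing12 :: "('a,'b) pre_digraph \<Rightarrow> 'a set \<Rightarrow> bool" where
  "competing12 D S \<longleftrightarrow> clique (competition_graph12 D) S"

definition loose :: "('a,'b) pre_digraph \<Rightarrow> 'a set set \<Rightarrow> bool" where
  "loose D P \<longleftrightarrow> (\<exists>A\<in>P. \<not> competing12 D A)"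

lemma pair_graph_competition_graph12:
  assumes "digraph D"
  shows "pair_graph (competition_graph12 D)"
proof -
  interpret digraph D by fact
  have "parcs (competition_graph12 D) \<subseteq> verts D \<times> verts D"
    by (auto simp: competition_graph12_def)
  then have "finite (parcs (competition_graph12 D))"
    by (rule finite_subset) simp
  then show ?thesis
    by unfold_locales
      (auto simp: competition_graph12_def symmetric_def sym_def insert_commute)
qed

end

theory Submission
  imports Defs
begin

text \<open>
  If \<open>D\<close> has a sink \<open>s\<close>, every vertex outside the partite set \<open>A\<close> of \<open>s\<close> dominates \<open>s\<close>. Otherwise let
  \<open>u\<close> and \<open>v\<close> be non-adjacent vertices of a partite set \<open>A\<close>. Their out-neighbourhoods are nonempty and
  disjoint and have no arcs between them, so both lie in one partite set \<open>B\<close>: every vertex outside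
  \<open>A\<close> dominates \<open>u\<close> or \<open>v\<close>, and every vertex outside \<open>A \<union> B\<close> dominates both. In either case a vertex
  \<open>c\<close> outside \<open>A \<union> B\<close> is adjacent to all other vertices outside \<open>A\<close>, and a non-sink \<open>a \<in> A\<close> that is
  not adjacent to \<open>c\<close> has \<open>c\<close> as its only out-neighbour, hence is adjacent to all other vertices
  outside \<open>A\<close>. All five claims follow from this.
\<close>

section \<open>Distances of at most two and adjacency in the competition graph, in terms of
  arcs\<close>

text \<open>A finite bound rules out the empty set of paths, whose infimum is
  \<open>\<infinity>\<close>; over a nonempty set the infimum is attained because
  \<open>enat\<close> is well-ordered.\<close>

lemma distance_le_iff:
  "distance G u v \<le> enat n \<longleftrightarrow> (\<exists>p. pre_digraph.apath G u p v \<and> length p \<le> n)"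
proof
  assume le: "distance G u v \<le> enat n"
  let ?L = "(\<lambda>p. enat (length p)) ` {p. pre_digraph.apath G u p v}"
  have "?L \<noteq> {}"
    using le by (force simp: distance_def top_enat_def)
  then have "Inf ?L \<in> ?L"
    by (meson ex_in_conv wellorder_InfI)
  then obtain p where "pre_digraph.apath G u p v" "Inf ?L = enat (length p)"
    by auto
  then show "\<exists>p. pre_digraph.apath G u p v \<and> length p \<le> n"
    using le by (auto simp: distance_def)
next
  assume "\<exists>p. pre_digraph.apath G u p v \<and> length p \<le> n"
  then obtain p where "pre_digraph.apath G u p v" "length p \<le> n"
    by auto
  then show "distance G u v \<le> enat n"
    unfolding distance_def by (intro INF_lower2[of p]) auto
qed

lemma (in wf_digraph) distance_le_1_iff:
  assumes "u \<noteq> v"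
  shows "distance G u v \<le> 1 \<longleftrightarrow> u \<rightarrow> v"
proof
  assume "distance G u v \<le> 1"
  then obtain p where p: "apath u p v" "length p \<le> 1"
    using distance_le_iff[of G u v 1] by (auto simp: one_enat_def)
  with assms obtain e where "p = [e]"
    by (cases p) (auto simp: apath_def awalk_def)
  with p show "u \<rightarrow> v"
    by (auto simp: apath_def awalk_def arcs_ends_conv)
next
  assume "u \<rightarrow> v"
  then obtain e where "e \<in> arcs G" "tail G e = u" "head G e = v"
    by (auto simp: arcs_ends_conv)
  then have "apath u [e] v"
    using assms by (auto simp: apath_def awalk_def)
  then show "distance G u v \<le> 1"
    using distance_le_iff[of G u v 1] by (force simp: one_enat_def)
qed

text \<open>The middle vertex need not be required to differ from the ends: \<open>x = u\<close> or
  \<open>x = v\<close> already yields the arc from \<open>u\<close> to \<open>v\<close>.\<close>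

lemma (in wf_digraph) distance_le_2_iff:
  assumes "u \<noteq> v"
  shows "distance G u v \<le> 2 \<longleftrightarrow> u \<rightarrow> v \<or> (\<exists>x. u \<rightarrow> x \<and> x \<rightarrow> v)"
proof
  assume "distance G u v \<le> 2"
  then obtain p where p: "apath u p v" "length p \<le> 2"
    using distance_le_iff[of G u v 2] by (auto simp: numeral_eq_enat)
  with assms consider e where "p = [e]" | e f where "p = [e, f]"
    by (cases p; cases "tl p") (auto simp: apath_def awalk_def)
  then show "u \<rightarrow> v \<or> (\<exists>x. u \<rightarrow> x \<and> x \<rightarrow> v)"
    using p by cases (auto simp: apath_def awalk_def arcs_ends_conv)
next
  assume "u \<rightarrow> v \<or> (\<exists>x. u \<rightarrow> x \<and> x \<rightarrow> v)"
  then consider "u \<rightarrow> v" | x where "u \<rightarrow> x" "x \<rightarrow> v" "x \<noteq> u" "x \<noteq> v"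
    by blast
  then show "distance G u v \<le> 2"
  proof cases
    case 1
    then have "distance G u v \<le> 1"
      using assms distance_le_1_iff by blast
    then show ?thesis
      by (rule order_trans) (simp add: one_enat_def numeral_eq_enat)
  next
    case 2
    then obtain e f where "e \<in> arcs G" "tail G e = u" "head G e = x"
      "f \<in> arcs G" "tail G f = x" "head G f = v"
      by (auto simp: arcs_ends_conv)
    then have "apath u [e, f] v"
      using assms 2 by (auto simp: apath_def awalk_def)
    then show ?thesis
      using distance_le_iff[of G u v 2] by (force simp: numeral_eq_enat)
  qed
qed

lemma dominates_del_vert_iff:
  "x \<rightarrow>\<^bsub>pre_digraph.del_vert G v\<^esub> y \<longleftrightarrow> x \<rightarrow>\<^bsub>G\<^esub> y \<and> x \<noteq> v \<and> y \<noteq> v"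
  by (auto simp: arcs_ends_conv pre_digraph.del_vert_def)

lemma (in fin_digraph) sink_iff: "sink G v \<longleftrightarrow> v \<in> verts G \<and> (\<forall>w. \<not> v \<rightarrow> w)"
proof -
  have "out_degree G v = 0 \<longleftrightarrow> out_arcs G v = {}"
    by (simp add: out_degree_def out_arcs_def)
  then show ?thesis
    by (auto simp: sink_def arcs_ends_conv out_arcs_def)
qed

text \<open>Since \<open>w\<close> is neither \<open>u\<close> nor \<open>v\<close>, deleting a
  vertex leaves the arcs from \<open>u\<close> and \<open>v\<close> to \<open>w\<close> intact. On a
  path of length two only the middle vertex can be the deleted one, which is what
  \<open>x \<noteq> u\<close> and \<open>x \<noteq> v\<close> exclude.\<close>

lemma (in wf_digraph) competition_graph12_iff:
  "u \<rightarrow>\<^bsub>competition_graph12 G\<^esub> v \<longleftrightarrow> u \<in> verts G \<and> v \<in> verts G \<and> u \<noteq> v \<and>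
    (\<exists>w. w \<noteq> u \<and> w \<noteq> v \<and>
      (u \<rightarrow> w \<and> (v \<rightarrow> w \<or> (\<exists>x. x \<noteq> u \<and> v \<rightarrow> x \<and> x \<rightarrow> w)) \<or>
       v \<rightarrow> w \<and> (u \<rightarrow> w \<or> (\<exists>x. x \<noteq> v \<and> u \<rightarrow> x \<and> x \<rightarrow> w))))"
proof -
  have 1: "distance (del_vert y) x w \<le> 1 \<longleftrightarrow> x \<rightarrow> w" if "x \<noteq> y" "w \<noteq> x" "w \<noteq> y" for x y w
    using wf_digraph.distance_le_1_iff[OF wf_digraph_del_vert, of x w y] that
    by (auto simp: dominates_del_vert_iff)
  have 2: "distance (del_vert y) x w \<le> 2 \<longleftrightarrow> x \<rightarrow> w \<or> (\<exists>z. z \<noteq> y \<and> x \<rightarrow> z \<and> z \<rightarrow> w)"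
    if "x \<noteq> y" "w \<noteq> x" "w \<noteq> y" for x y w
    using wf_digraph.distance_le_2_iff[OF wf_digraph_del_vert, of x w y] that
    by (auto simp: dominates_del_vert_iff)
  have verts: "w \<in> verts G" if "x \<rightarrow> w" for x w
    using that by (auto simp: arcs_ends_conv)
  have iff: "(w \<in> verts G - {u, v} \<and>
      (distance (del_vert v) u w \<le> 1 \<and> distance (del_vert u) v w \<le> 2 \<or>
       distance (del_vert u) v w \<le> 1 \<and> distance (del_vert v) u w \<le> 2)) \<longleftrightarrow>
    (w \<noteq> u \<and> w \<noteq> v \<and>
      (u \<rightarrow> w \<and> (v \<rightarrow> w \<or> (\<exists>x. x \<noteq> u \<and> v \<rightarrow> x \<and> x \<rightarrow> w)) \<or>
       v \<rightarrow> w \<and> (u \<rightarrow> w \<or> (\<exists>x. x \<noteq> v \<and> u \<rightarrow> x \<and> x \<rightarrow> w))))" if "u \<noteq> v" for w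
  proof (cases "w = u \<or> w = v")
    case False
    then have "distance (del_vert v) u w \<le> 1 \<longleftrightarrow> u \<rightarrow> w" "distance (del_vert u) v w \<le> 1 \<longleftrightarrow> v \<rightarrow> w"
      "distance (del_vert v) u w \<le> 2 \<longleftrightarrow> u \<rightarrow> w \<or> (\<exists>x. x \<noteq> v \<and> u \<rightarrow> x \<and> x \<rightarrow> w)"
      "distance (del_vert u) v w \<le> 2 \<longleftrightarrow> v \<rightarrow> w \<or> (\<exists>x. x \<noteq> u \<and> v \<rightarrow> x \<and> x \<rightarrow> w)"
      using that by (simp_all add: 1 2)
    then show ?thesis
      using verts False by blast
  qed auto
  then show ?thesis
    by (cases "u = v") (simp_all add: competition_graph12_def Bex_def iff del: Diff_iff)
qed

section \<open>Connectedness and the diameter of components\<close>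

text \<open>Take the first step of an undirected walk from \<open>u\<close> to \<open>v\<close>.
  Thus a component with two or more vertices has no isolated vertex.\<close>

lemma connected_imp_adjacent:
  assumes "Digraph_Component.connected G" "u \<in> verts G" "v \<in> verts G" "u \<noteq> v"
  shows "\<exists>w. u \<rightarrow>\<^bsub>G\<^esub> w \<or> w \<rightarrow>\<^bsub>G\<^esub> u"
proof -
  have "(u, v) \<in> rtrancl_on (verts G) ((arcs_ends G)\<^sup>s)"
    using assms by (auto simp: connected_conv)
  then have "(u, v) \<in> ((arcs_ends G)\<^sup>s)\<^sup>*"
    by (simp add: rtrancl_on_rtranclI)
  then show ?thesis
    using assms(4) by (cases rule: converse_rtranclE) (auto simp: symcl_def)
qed

lemma (in wf_digraph) connected_if_distance_le_2:
  assumes "verts G \<noteq> {}"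
    and near: "\<And>u v. u \<in> verts G \<Longrightarrow> v \<in> verts G \<Longrightarrow> u \<noteq> v \<Longrightarrow> u \<rightarrow> v \<or> (\<exists>w. u \<rightarrow> w \<and> w \<rightarrow> v)"
  shows "Digraph_Component.connected G"
proof (rule connectedI)
  fix u v
  assume uv: "u \<in> verts G" "v \<in> verts G"
  have "u \<rightarrow>\<^sup>* v"
  proof (cases "u = v")
    case True
    then show ?thesis
      using uv by simp
  next
    case False
    then show ?thesis
      using near[OF uv] reachable_adjI reachable_trans by blast
  qed
  then show "u \<rightarrow>\<^sup>*\<^bsub>mk_symmetric G\<^esub> v"
    by (rule reachable_mk_symmetricI)
qed fact

text \<open>All non-isolated vertices lie in \<open>S\<close>, so a component \<open>H\<close> with
  two distinct vertices is contained in the subgraph induced by \<open>S\<close>. That subgraph is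
  connected by \<open>near\<close>, so maximality makes it equal to \<open>H\<close>. In the
  intended use \<open>S\<close> is the set of non-sinks.\<close>

lemma component_diameter_le_2:
  assumes G: "pair_graph G"
    and H: "connected_component G H"
    and S: "S \<subseteq> pverts G"
    and iso: "\<And>u v. (u, v) \<in> parcs G \<Longrightarrow> u \<in> S"
    and near: "\<And>u v. u \<in> S \<Longrightarrow> v \<in> S \<Longrightarrow> u \<noteq> v \<Longrightarrow>
      (u, v) \<in> parcs G \<or> (\<exists>w. (u, w) \<in> parcs G \<and> (w, v) \<in> parcs G)"
  shows "diameter H \<le> 2"
proof -
  interpret pair_graph G by fact
  have sub: "subgraph H G" and con: "Digraph_Component.connected H"
    and max: "\<And>H'. subgraph H H' \<Longrightarrow> subgraph H' G \<Longrightarrow> Digraph_Component.connected H' \<Longrightarrow> H' = H"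
    using H by (auto simp: connected_component_def max_subgraph_def)
  have "distance H u v \<le> 2" if uv: "u \<in> verts H" "v \<in> verts H" for u v
  proof (cases "u = v")
    case True
    then have "pre_digraph.apath H u [] v"
      using uv by (simp add: pre_digraph.apath_def pre_digraph.awalk_def
          pre_digraph.cas.simps pre_digraph.awalk_verts.simps)
    then show ?thesis
      using distance_le_iff[of H u v 2] by (force simp: numeral_eq_enat)
  next
    case False
    have HS: "verts H \<subseteq> S"
    proof
      fix x
      assume x: "x \<in> verts H"
      obtain y where "y \<in> verts H" "x \<noteq> y"
        using uv False by blast
      then obtain w where "x \<rightarrow>\<^bsub>H\<^esub> w \<or> w \<rightarrow>\<^bsub>H\<^esub> x"
        using connected_imp_adjacent[OF con x] by blast
      then have "(x, w) \<in> parcs G \<or> (w, x) \<in> parcs G"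
        using adj_mono[OF _ sub] by auto
      then show "x \<in> S"
        using iso graph_symmetric by auto
    qed
    let ?K = "G \<restriction> S"
    \<comment> \<open>Restricting to \<open>S\<close> loses no arc: by \<open>iso\<close> and
      symmetry both ends of every arc of \<open>G\<close> lie in \<open>S\<close>.\<close>
    have K_iff: "x \<rightarrow>\<^bsub>?K\<^esub> y \<longleftrightarrow> (x, y) \<in> parcs G" for x y
      using iso graph_symmetric by (force simp: arcs_ends_conv)
    have K_near: "x \<rightarrow>\<^bsub>?K\<^esub> y \<or> (\<exists>w. x \<rightarrow>\<^bsub>?K\<^esub> w \<and> w \<rightarrow>\<^bsub>?K\<^esub> y)" if "x \<in> S" "y \<in> S" "x \<noteq> y" for x y
      using near[OF that] by (simp only: K_iff)
    have wf: "wf_digraph ?K"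
      by (rule wellformed_induce_subgraph)
    have KG: "subgraph ?K G"
      using S subgraph_induce_subgraphI by simp
    have "Digraph_Component.connected ?K"
      using HS uv K_near by (intro wf_digraph.connected_if_distance_le_2[OF wf]) auto
    moreover have "subgraph H ?K"
    proof -
      have "arcs H \<subseteq> arcs ?K"
      proof
        fix e
        assume e: "e \<in> arcs H"
        interpret H: wf_digraph H
          using sub by auto
        have "tail H e \<in> S" "head H e \<in> S"
          using e HS by auto
        then show "e \<in> arcs ?K"
          using e sub by (auto simp: subgraph_def compatible_def)
      qed
      then show ?thesis
        using sub wf HS by (auto simp: subgraph_def compatible_def)
    qed
    ultimately have "?K = H"
      using max KG by blast
    then show ?thesis
      using wf_digraph.distance_le_2_iff[OF wf False] K_near[of u v] uv HS False by auto
  qed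
  then show ?thesis
    by (auto simp: diameter_def intro!: SUP_least)
qed

text \<open>\<open>T\<close> stands for \<open>{s}\<close> (with \<open>B\<close> arbitrary) or \<open>{u, v}\<close>.\<close>

locale targeted_multipartite_tournament =
  fixes D :: "('a, 'b) pre_digraph" and P :: "'a set set" and A B T :: "'a set"
  assumes tournament: "multipartite_tournament D P"
    and A: "A \<in> P" and B: "B \<in> P" and A_neq_B: "A \<noteq> B"
    and some_target: "\<And>x. x \<in> verts D \<Longrightarrow> x \<notin> A \<Longrightarrow> \<exists>t\<in>T. x \<rightarrow>\<^bsub>D\<^esub> t"
    and every_target: "\<And>x t. x \<in> verts D \<Longrightarrow> x \<notin> A \<Longrightarrow> x \<notin> B \<Longrightarrow> t \<in> T \<Longrightarrow> x \<rightarrow>\<^bsub>D\<^esub> t"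

section \<open>Elementary facts on multipartite tournaments\<close>

lemma multipartite_tournamentD:
  assumes "multipartite_tournament D P"
  shows "digraph D" "\<And>X Y. X \<in> P \<Longrightarrow> Y \<in> P \<Longrightarrow> X \<noteq> Y \<Longrightarrow> X \<inter> Y = {}"
    "\<Union>P = verts D" "{} \<notin> P"
    "\<And>u v. u \<rightarrow>\<^bsub>D\<^esub> v \<Longrightarrow> \<not> v \<rightarrow>\<^bsub>D\<^esub> u"
proof -
  have part: "partition_on (verts D) P"
    and ori: "orientation_of D (complete_multipartite_graph P)"
    using assms by (auto simp: multipartite_tournament_def)
  show "digraph D" "\<And>u v. u \<rightarrow>\<^bsub>D\<^esub> v \<Longrightarrow> \<not> v \<rightarrow>\<^bsub>D\<^esub> u"
    using ori by (auto simp: orientation_of_def)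
  show "X \<inter> Y = {}" if "X \<in> P" "Y \<in> P" "X \<noteq> Y" for X Y
    using part that by (auto simp: partition_on_def disjoint_def)
  show "\<Union>P = verts D" "{} \<notin> P"
    using part by (auto simp: partition_on_def)
qed

lemma multipartite_tournament_dominates_iff:
  assumes "multipartite_tournament D P"
  shows "u \<rightarrow>\<^bsub>D\<^esub> v \<or> v \<rightarrow>\<^bsub>D\<^esub> u \<longleftrightarrow> (\<exists>X\<in>P. \<exists>Y\<in>P. X \<noteq> Y \<and> u \<in> X \<and> v \<in> Y)"
  using assms
  by (simp add: multipartite_tournament_def orientation_of_def complete_multipartite_graph_def)

lemma multipartite_tournament_not_same_part:
  assumes "multipartite_tournament D P" "u \<rightarrow>\<^bsub>D\<^esub> v" "X \<in> P" "u \<in> X"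
  shows "v \<notin> X"
proof
  assume "v \<in> X"
  obtain Y Z where "Y \<in> P" "Z \<in> P" "Y \<noteq> Z" "u \<in> Y" "v \<in> Z"
    using multipartite_tournament_dominates_iff[OF assms(1), of u v] assms by blast
  then show False
    using multipartite_tournamentD(2)[OF assms(1), of X Y]
      multipartite_tournamentD(2)[OF assms(1), of X Z] assms \<open>v \<in> X\<close> by blast
qed

lemma multipartite_tournament_total:
  assumes "multipartite_tournament D P" "u \<in> X" "X \<in> P" "v \<in> verts D" "v \<notin> X"
  shows "u \<rightarrow>\<^bsub>D\<^esub> v \<or> v \<rightarrow>\<^bsub>D\<^esub> u"
proof -
  obtain Y where "Y \<in> P" "v \<in> Y"
    using multipartite_tournamentD(3) assms by blast
  then show ?thesis
    using multipartite_tournament_dominates_iff[OF assms(1), of u v] assms by blast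
qed

section \<open>Adjacency in the competition graph of a targeted tournament\<close>

context targeted_multipartite_tournament
begin

lemmas tournamentD = multipartite_tournamentD[OF tournament]
  multipartite_tournament_not_same_part[OF tournament] multipartite_tournament_total[OF tournament]

sublocale digraph D
  by (rule tournamentD)

abbreviation adj :: "'a \<Rightarrow> 'a \<Rightarrow> bool"  (infix "\<sim>" 50) where
  "u \<sim> v \<equiv> u \<rightarrow>\<^bsub>competition_graph12 D\<^esub> v"

lemma dominates_in_verts: "u \<rightarrow>\<^bsub>D\<^esub> v \<Longrightarrow> u \<in> verts D \<and> v \<in> verts D"
  by auto

lemma adj_sym: "u \<sim> v \<longleftrightarrow> v \<sim> u"
  unfolding competition_graph12_iff by blast

lemma adj_not_sink: "u \<sim> v \<Longrightarrow> \<not> sink D u"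
  unfolding competition_graph12_iff sink_iff by blast

lemma adj_common:
  assumes "u \<rightarrow>\<^bsub>D\<^esub> w" "v \<rightarrow>\<^bsub>D\<^esub> w" "u \<noteq> v"
  shows "u \<sim> v"
proof -
  have "w \<noteq> u" "w \<noteq> v"
    using assms tournamentD(5) by blast+
  then show ?thesis
    using assms dominates_in_verts unfolding competition_graph12_iff by blast
qed

text \<open>The path through \<open>x\<close> has to survive the deletion of \<open>u\<close>, hence
  \<open>x \<noteq> u\<close>. The end \<open>w\<close> differs from \<open>v\<close> because
  \<open>v \<rightarrow> x\<close> and \<open>x \<rightarrow> v\<close> cannot both be arcs.\<close>

lemma adj_two_step:
  assumes "u \<rightarrow>\<^bsub>D\<^esub> w" "v \<rightarrow>\<^bsub>D\<^esub> x" "x \<rightarrow>\<^bsub>D\<^esub> w" "u \<noteq> v" "x \<noteq> u"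
  shows "u \<sim> v"
proof -
  have "w \<noteq> u" "w \<noteq> v"
    using assms tournamentD(5) by blast+
  then show ?thesis
    using assms dominates_in_verts unfolding competition_graph12_iff by blast
qed

text \<open>\<open>x\<close> dominates some target and \<open>c\<close> dominates every target, so
  they have a common out-neighbour.\<close>

lemma outside_adj:
  assumes "c \<in> verts D" "c \<notin> A" "c \<notin> B" "x \<in> verts D" "x \<notin> A" "x \<noteq> c"
  shows "c \<sim> x"
proof -
  obtain t where "t \<in> T" "x \<rightarrow>\<^bsub>D\<^esub> t"
    using some_target assms by blast
  then show ?thesis
    using every_target assms adj_common by blast
qed

lemma sink_in_A: "sink D v \<Longrightarrow> v \<in> A"
  using some_target[of v] by (auto simp: sink_iff)

text \<open>An out-neighbour \<open>y \<noteq> c\<close> of \<open>a\<close> lies outside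
  \<open>A\<close> and so dominates some target \<open>t\<close>. As \<open>c\<close> dominates
  \<open>t\<close> too, the path \<open>a\<close>, \<open>y\<close>, \<open>t\<close> would make
  \<open>a\<close> and \<open>c\<close> adjacent. Being no sink, \<open>a\<close> has an
  out-neighbour, which can then only be \<open>c\<close>.\<close>

lemma not_adj_outside:
  assumes a: "a \<in> A" "\<not> sink D a" and c: "c \<in> verts D" "c \<notin> A" "c \<notin> B" and "\<not> a \<sim> c"
  shows "a \<rightarrow>\<^bsub>D\<^esub> y \<longleftrightarrow> y = c"
proof -
  have "y = c" if y: "a \<rightarrow>\<^bsub>D\<^esub> y" for y
  proof (rule ccontr)
    assume "y \<noteq> c"
    have "y \<in> verts D" "y \<notin> A"
      using tournamentD(6)[OF y A] dominates_in_verts[OF y] a by blast+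
    then obtain t where "t \<in> T" "y \<rightarrow>\<^bsub>D\<^esub> t"
      using some_target by blast
    then have "c \<sim> a"
      using adj_two_step[of c t a y] every_target[OF c] c y a \<open>y \<noteq> c\<close> by blast
    then show False
      using \<open>\<not> a \<sim> c\<close> adj_sym by blast
  qed
  moreover have "\<exists>y. a \<rightarrow>\<^bsub>D\<^esub> y"
    using a A tournamentD(3) unfolding sink_iff by blast
  ultimately show ?thesis
    by blast
qed

text \<open>By the previous lemma \<open>a\<close> dominates \<open>c\<close>, which dominates every
  target. So \<open>a\<close> reaches in two steps, through \<open>c\<close>, a target that
  \<open>x\<close> dominates.\<close>

lemma not_adj_outside_imp_adj:
  assumes "a \<in> A" "\<not> sink D a" "c \<in> verts D" "c \<notin> A" "c \<notin> B" "\<not> a \<sim> c"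
    and "x \<in> verts D" "x \<notin> A" "x \<noteq> c"
  shows "a \<sim> x"
proof -
  have "a \<rightarrow>\<^bsub>D\<^esub> c"
    using not_adj_outside assms by blast
  moreover obtain t where "t \<in> T" "x \<rightarrow>\<^bsub>D\<^esub> t"
    using some_target assms by blast
  ultimately have "x \<sim> a"
    using adj_two_step[of x t a c] every_target[of c t] assms by blast
  then show ?thesis
    using adj_sym by blast
qed

lemma three_parts:
  obtains b c where "b \<in> B" "b \<in> verts D" "b \<notin> A" "c \<in> verts D" "c \<notin> A" "c \<notin> B" "b \<noteq> c"
proof -
  have "\<not> P \<subseteq> {A, B}"
  proof
    assume "P \<subseteq> {A, B}"
    then have "card P \<le> card {A, B}"
      by (intro card_mono) auto
    also have "\<dots> \<le> 2"
      by (simp add: card_insert_if)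
    finally show False
      using tournament by (simp add: multipartite_tournament_def)
  qed
  then obtain C where C: "C \<in> P" "C \<noteq> A" "C \<noteq> B"
    by blast
  obtain b c where "b \<in> B" "c \<in> C"
    using B C tournamentD(4) by (metis ex_in_conv)
  then show ?thesis
    using that[of b c] tournamentD(2)[of A B] tournamentD(2)[of A C] tournamentD(2)[of B C]
      tournamentD(3) A B A_neq_B C by blast
qed

section \<open>Non-sinks are at distance at most two\<close>

text \<open>This is the case in which \<open>c\<close> is adjacent to just one of two non-sinks of
  \<open>A\<close>. The other one, \<open>a'\<close>, has \<open>c\<close> as its only out-neighbour
  and is adjacent to everything else outside \<open>A\<close>. The argument distinguishes where an
  out-neighbour \<open>y\<close> of \<open>a\<close> lies.\<close>

lemma adj_or_common_neighbour_in_A: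
  assumes a: "a \<in> A" "\<not> sink D a" and a': "a' \<in> A" "\<not> sink D a'" and "a \<noteq> a'"
    and c: "c \<in> verts D" "c \<notin> A" "c \<notin> B" and adj: "a \<sim> c" "\<not> a' \<sim> c"
  shows "a \<sim> a' \<or> (\<exists>w. a \<sim> w \<and> w \<sim> a')"
proof -
  obtain b where b: "b \<in> B" "b \<in> verts D" "b \<notin> A"
    using three_parts by blast
  have a'_c: "a' \<rightarrow>\<^bsub>D\<^esub> c"
    using not_adj_outside a' c adj by blast
  have a'_adj: "x \<sim> a'" if "x \<in> verts D" "x \<notin> A" "x \<noteq> c" for x
    using not_adj_outside_imp_adj a' c adj that adj_sym by blast
  obtain y where y: "a \<rightarrow>\<^bsub>D\<^esub> y"
    using a A tournamentD(3) unfolding sink_iff by blast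
  have y': "y \<in> verts D" "y \<notin> A"
    using tournamentD(6)[OF y A] dominates_in_verts[OF y] a by blast+
  consider "y = c" | "y \<noteq> c" "y \<notin> B" "a \<sim> y" | "y \<noteq> c" "y \<notin> B" "\<not> a \<sim> y" | "y \<in> B"
    by blast
  then show ?thesis
  proof cases
    case 1
    then show ?thesis
      using adj_common y a'_c \<open>a \<noteq> a'\<close> by blast
  next
    case 2
    then show ?thesis
      using a'_adj y' by blast
  next
    case 3
    \<comment> \<open>Now \<open>y\<close>, lying outside \<open>A \<union> B\<close>, takes the
      role of \<open>c\<close> for \<open>a\<close>. This makes \<open>b\<close> a common
      neighbour.\<close>
    then have "a \<sim> b"
      using not_adj_outside_imp_adj[of a y b] a y' b by blast
    then show ?thesis
      using a'_adj b c by blast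
  next
    case 4
    \<comment> \<open>As \<open>y\<close> and \<open>c\<close> lie in different partite sets, an arc
      joins them. If it points to \<open>c\<close>, then \<open>a\<close> reaches \<open>c\<close>
      through \<open>y\<close>; otherwise \<open>a'\<close> reaches \<open>y\<close> through
      \<open>c\<close>. Either way \<open>a\<close> and \<open>a'\<close> compete.\<close>
    then have "y \<rightarrow>\<^bsub>D\<^esub> c \<or> c \<rightarrow>\<^bsub>D\<^esub> y"
      using tournamentD(7)[of y B c] B c by blast
    then have "a' \<sim> a \<or> a \<sim> a'"
      using adj_two_step[of a' c a y] adj_two_step[of a y a' c] y a'_c \<open>a \<noteq> a'\<close> a a' y' c by blast
    then show ?thesis
      using adj_sym by blast
  qed
qed

text \<open>The vertex \<open>c\<close> is adjacent to all other vertices outside \<open>A\<close>,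
  so it usually serves as the common neighbour. For non-sinks of \<open>A\<close> that are not
  adjacent to \<open>c\<close>, the vertex \<open>b\<close> takes its place.\<close>

lemma adj_or_common_neighbour:
  assumes u: "u \<in> verts D" "\<not> sink D u" and v: "v \<in> verts D" "\<not> sink D v" and "u \<noteq> v"
  shows "u \<sim> v \<or> (\<exists>w. u \<sim> w \<and> w \<sim> v)"
proof -
  obtain b c where b: "b \<in> B" "b \<in> verts D" "b \<notin> A"
    and c: "c \<in> verts D" "c \<notin> A" "c \<notin> B" and "b \<noteq> c"
    using three_parts by blast
  \<comment> \<open>If \<open>a\<close> is adjacent to \<open>c\<close>, go through \<open>c\<close>
    unless \<open>x\<close> is \<open>c\<close> itself. Otherwise \<open>a\<close> is adjacent to
    every vertex outside \<open>A\<close> except \<open>c\<close>, and \<open>c\<close> is reached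
    through \<open>b\<close>.\<close>
  have mixed: "x \<sim> a \<or> (\<exists>w. x \<sim> w \<and> w \<sim> a)"
    if "a \<in> A" "\<not> sink D a" "x \<in> verts D" "x \<notin> A" for a x
  proof (cases "a \<sim> c")
    case True
    then show ?thesis
      using outside_adj[of c x] that c adj_sym by blast
  next
    case False
    then have "y \<sim> a" if "y \<in> verts D" "y \<notin> A" "y \<noteq> c" for y
      using not_adj_outside_imp_adj[of a c y] \<open>a \<in> A\<close> \<open>\<not> sink D a\<close> c that adj_sym by blast
    then show ?thesis
      using that b c \<open>b \<noteq> c\<close> outside_adj[of c b] by (cases "x = c") blast+
  qed
  show ?thesis
  proof (cases "u \<in> A"; cases "v \<in> A")
    assume "u \<notin> A" "v \<notin> A"
    then show ?thesis
      using outside_adj[of c] u v c \<open>u \<noteq> v\<close> adj_sym by (cases "u = c"; cases "v = c") blast+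
  next
    assume "u \<in> A" "v \<notin> A"
    then show ?thesis
      using mixed u v adj_sym by blast
  next
    assume "u \<notin> A" "v \<in> A"
    then show ?thesis
      using mixed u v adj_sym by blast
  next
    assume A: "u \<in> A" "v \<in> A"
    consider "u \<sim> c" "v \<sim> c" | "u \<sim> c" "\<not> v \<sim> c" | "\<not> u \<sim> c" "v \<sim> c" | "\<not> u \<sim> c" "\<not> v \<sim> c"
      by blast
    then show ?thesis
    proof cases
      case 1
      then show ?thesis
        using adj_sym by blast
    next
      case 2
      then show ?thesis
        using adj_or_common_neighbour_in_A[of u v c] A u v c \<open>u \<noteq> v\<close> by blast
    next
      case 3
      then show ?thesis
        using adj_or_common_neighbour_in_A[of v u c] A u v c \<open>u \<noteq> v\<close> adj_sym by blast
    next
      case 4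
      then have "u \<sim> b" "v \<sim> b"
        using not_adj_outside_imp_adj A u v b c \<open>b \<noteq> c\<close> by blast+
      then show ?thesis
        using adj_sym by blast
    qed
  qed
qed

section \<open>The five claims for targeted tournaments\<close>

text \<open>Unless \<open>S\<close> lies in \<open>A \<union> B\<close>, it contains some
  \<open>c\<close> outside that union. As \<open>c\<close> is adjacent to all other vertices outside
  \<open>A\<close>, \<open>c\<close> is then the only vertex of \<open>S\<close> outside
  \<open>A\<close>.\<close>

lemma stable_set_meets_at_most_two:
  assumes "stable_set (competition_graph12 D) S"
  shows "card {X \<in> P. X \<inter> S \<noteq> {}} \<le> 2"
proof -
  have S: "S \<subseteq> verts D" and stable: "\<And>u v. u \<in> S \<Longrightarrow> v \<in> S \<Longrightarrow> \<not> u \<sim> v"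
    using assms by (auto simp: stable_set_def competition_graph12_def)
  have "\<exists>Y. {X \<in> P. X \<inter> S \<noteq> {}} \<subseteq> {A, Y}"
  proof (cases "S \<subseteq> A \<union> B")
    case True
    then have "{X \<in> P. X \<inter> S \<noteq> {}} \<subseteq> {A, B}"
      using tournamentD(2) A B by blast
    then show ?thesis
      by blast
  next
    case False
    then obtain c where c: "c \<in> S" "c \<notin> A" "c \<notin> B"
      by blast
    then obtain Y where Y: "Y \<in> P" "c \<in> Y"
      using S tournamentD(3) by blast
    have "S \<subseteq> A \<union> {c}"
      using outside_adj[of c] stable S c by blast
    then have "{X \<in> P. X \<inter> S \<noteq> {}} \<subseteq> {A, Y}"
      using tournamentD(2) A Y by blast
    then show ?thesis
      by blast
  qed
  then obtain Y where "{X \<in> P. X \<inter> S \<noteq> {}} \<subseteq> {A, Y}"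
    by blast
  then have "card {X \<in> P. X \<inter> S \<noteq> {}} \<le> card {A, Y}"
    by (intro card_mono) auto
  also have "\<dots> \<le> 2"
    by (simp add: card_insert_if)
  finally show ?thesis .
qed

text \<open>Any partite set other than \<open>A\<close> and \<open>B\<close> is a clique, since each
  of its vertices can be taken as \<open>c\<close> in \<open>outside_adj\<close>.\<close>

lemma card_not_competing12: "card {X \<in> P. \<not> competing12 D X} \<le> 2"
proof -
  have "competing12 D X" if X: "X \<in> P" "X \<noteq> A" "X \<noteq> B" for X
  proof -
    have "X \<inter> A = {}" "X \<inter> B = {}" "X \<subseteq> verts D"
      using tournamentD(2,3) X A B by blast+
    then have "u \<sim> v" if "u \<in> X" "v \<in> X" "u \<noteq> v" for u v
      using outside_adj[of u v] that by blast
    then show ?thesis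
      using \<open>X \<subseteq> verts D\<close> unfolding competing12_def clique_def
      by (simp add: competition_graph12_def)
  qed
  then have "{X \<in> P. \<not> competing12 D X} \<subseteq> {A, B}"
    by blast
  then have "card {X \<in> P. \<not> competing12 D X} \<le> card {A, B}"
    by (intro card_mono) auto
  also have "\<dots> \<le> 2"
    by (simp add: card_insert_if)
  finally show ?thesis .
qed

text \<open>Upper bound: the sinks together with \<open>b\<close> and \<open>c\<close> dominate, as
  \<open>c\<close> is adjacent to every other vertex outside \<open>A\<close> and each non-sink of
  \<open>A\<close> is adjacent to \<open>c\<close> or to \<open>b\<close>. Lower bound: sinks are
  isolated, so a dominating set contains all of them, and it needs a further vertex to cover the
  non-sink \<open>b\<close>.\<close>

lemma domination_number_bounds:
  "domination_number (competition_graph12 D) \<in> {card {v. sink D v} + 1, card {v. sink D v} + 2}"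
proof -
  let ?G = "with_proj (competition_graph12 D)"
  let ?S = "{v. sink D v}"
  let ?dom = "\<lambda>n. \<exists>S. finite S \<and> dominating_set ?G S \<and> card S = n"
  have verts: "verts ?G = verts D"
    by (simp add: competition_graph12_def)
  have fin: "finite ?S"
    by (rule finite_subset[OF _ finite_verts]) (auto simp: sink_iff)
  obtain b c where b: "b \<in> B" "b \<in> verts D" "b \<notin> A"
    and c: "c \<in> verts D" "c \<notin> A" "c \<notin> B" and "b \<noteq> c"
    using three_parts by blast
  have not_sink: "\<not> sink D b" "\<not> sink D c"
    using sink_in_A b c by blast+
  have dominated: "v \<in> ?S \<union> {b, c} \<or> (\<exists>s\<in>?S \<union> {b, c}. s \<sim> v)" if v: "v \<in> verts D" for v
  proof (cases "v \<in> A")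
    case True
    then show ?thesis
      using not_adj_outside_imp_adj[of v c b] b c \<open>b \<noteq> c\<close> adj_sym by blast
  next
    case False
    then show ?thesis
      using outside_adj[of c v] c v by blast
  qed
  have "dominating_set ?G (?S \<union> {b, c})"
    unfolding dominating_set_def verts using dominated b c by (auto simp: sink_iff)
  moreover have "card (?S \<union> {b, c}) = card ?S + 2"
    using fin not_sink \<open>b \<noteq> c\<close> by (subst card_Un_disjoint) auto
  ultimately have ex: "?dom (card ?S + 2)"
    using fin by (intro exI[of _ "?S \<union> {b, c}"]) simp
  then have le: "domination_number ?G \<le> card ?S + 2"
    unfolding domination_number_def by (rule Least_le)
  from ex have "?dom (domination_number ?G)"
    unfolding domination_number_def by (rule LeastI)
  then obtain S where S: "finite S" "dominating_set ?G S" "card S = domination_number ?G"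
    by blast
  have dom: "v \<in> S \<or> (\<exists>s\<in>S. s \<sim> v)" if "v \<in> verts D" for v
    using S(2) that unfolding dominating_set_def verts by blast
  have sub: "?S \<subseteq> S"
    using dom adj_not_sink adj_sym by (auto simp: sink_iff) (metis sink_iff)
  \<comment> \<open>Either \<open>b\<close> itself is in \<open>S\<close>, or it has a neighbour in
    \<open>S\<close>, and neighbours are never sinks.\<close>
  have "\<exists>s\<in>S. \<not> sink D s"
    using dom[of b] b not_sink adj_not_sink by blast
  then have "?S \<subset> S"
    using sub by blast
  then have "card ?S < card S"
    by (rule psubset_card_mono[OF S(1)])
  with le S(3) show ?thesis
    by auto
qed

lemma diameter_le_2_competition_graph12:
  assumes "connected_component (competition_graph12 D) H"
  shows "diameter H \<le> 2"
proof (rule component_diameter_le_2[OF pair_graph_competition_graph12 assms])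
  show "digraph D"
    by unfold_locales
  show "{v \<in> verts D. \<not> sink D v} \<subseteq> pverts (competition_graph12 D)"
    by (auto simp: competition_graph12_def)
  show "u \<in> {v \<in> verts D. \<not> sink D v}" if "(u, v) \<in> parcs (competition_graph12 D)" for u v
  proof -
    have "u \<sim> v"
      using that by simp
    then have "u \<in> verts D"
      unfolding competition_graph12_iff by blast
    then show ?thesis
      using adj_not_sink[OF \<open>u \<sim> v\<close>] by blast
  qed
  show "(u, v) \<in> parcs (competition_graph12 D) \<or>
      (\<exists>w. (u, w) \<in> parcs (competition_graph12 D) \<and> (w, v) \<in> parcs (competition_graph12 D))"
    if "u \<in> {v \<in> verts D. \<not> sink D v}" "v \<in> {v \<in> verts D. \<not> sink D v}" "u \<noteq> v" for u v
    using adj_or_common_neighbour[of u v] that by simp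
qed

text \<open>A sink is isolated and lies in \<open>A\<close>, so together with a vertex
  \<open>b\<close> outside \<open>A\<close> it refutes connectedness. Without sinks any two distinct
  vertices are adjacent or have a common neighbour.\<close>

lemma connected_competition_graph12_iff:
  "(\<not> (\<exists>v. sink D v)) \<longleftrightarrow> Digraph_Component.connected (competition_graph12 D)"
proof
  interpret C: pair_graph "competition_graph12 D"
    by (rule pair_graph_competition_graph12) unfold_locales
  obtain b where b: "b \<in> verts D" "b \<notin> A"
    using three_parts by blast
  have verts: "verts (competition_graph12 D) = verts D"
    by (simp add: competition_graph12_def)
  show "Digraph_Component.connected (competition_graph12 D)" if "\<not> (\<exists>v. sink D v)"
  proof (rule C.connected_if_distance_le_2)
    show "pverts (competition_graph12 D) \<noteq> {}"
      using b verts by auto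
    show "(u, v) \<in> parcs (competition_graph12 D) \<or>
      (\<exists>w. (u, w) \<in> parcs (competition_graph12 D) \<and> (w, v) \<in> parcs (competition_graph12 D))"
      if "u \<in> pverts (competition_graph12 D)" "v \<in> pverts (competition_graph12 D)" "u \<noteq> v" for u v
      using adj_or_common_neighbour[of u v] that \<open>\<not> (\<exists>v. sink D v)\<close> verts by simp
  qed
  show "\<not> (\<exists>v. sink D v)" if con: "Digraph_Component.connected (competition_graph12 D)"
  proof
    assume "\<exists>v. sink D v"
    then obtain v where v: "sink D v"
      by blast
    then have "v \<in> verts D" "v \<noteq> b"
      using sink_in_A b by (auto simp: sink_iff)
    then obtain w where "v \<sim> w \<or> w \<sim> v"
      using connected_imp_adjacent[OF con, of v b] verts b by auto
    then show False
      using adj_sym adj_not_sink v by blast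
  qed
qed

end

section \<open>Targets in a loose multipartite tournament\<close>

lemma loose_multipartite_tournament_targeted:
  assumes tour: "multipartite_tournament D P" and "loose D P"
  shows "\<exists>A B T. targeted_multipartite_tournament D P A B T"
proof -
  note D = multipartite_tournamentD[OF tour] multipartite_tournament_not_same_part[OF tour]
    multipartite_tournament_total[OF tour]
  interpret digraph D by (rule D)
  have other: "\<exists>B\<in>P. B \<noteq> A" for A
  proof (rule ccontr)
    assume "\<not> (\<exists>B\<in>P. B \<noteq> A)"
    then have "card P \<le> card {A}"
      by (intro card_mono) auto
    then show False
      using tour by (simp add: multipartite_tournament_def)
  qed
  show ?thesis
  proof (cases "\<exists>v. sink D v")
    case True
    then obtain s where s: "sink D s"
      by blast
    then obtain A where A: "A \<in> P" "s \<in> A"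
      using D(3) by (auto simp: sink_iff)
    obtain B where B: "B \<in> P" "B \<noteq> A"
      using other by blast
    have "x \<rightarrow>\<^bsub>D\<^esub> s" if "x \<in> verts D" "x \<notin> A" for x
      using D(7)[of s A x] A that s by (auto simp: sink_iff)
    then have "targeted_multipartite_tournament D P A B {s}"
      using tour A B by unfold_locales auto
    then show ?thesis
      by blast
  next
    case False
    obtain A u v where A: "A \<in> P" and u: "u \<in> A" and v: "v \<in> A" and "u \<noteq> v"
      and nadj: "\<not> u \<rightarrow>\<^bsub>competition_graph12 D\<^esub> v"
      using \<open>loose D P\<close> D(3)
      by (auto simp: loose_def competing12_def clique_def competition_graph12_def)
    have uv_verts: "u \<in> verts D" "v \<in> verts D"
      using A u v D(3) by auto
    have out: "y \<in> verts D \<and> y \<notin> A \<and> y \<noteq> u \<and> y \<noteq> v" if "x \<rightarrow>\<^bsub>D\<^esub> y" "x \<in> A" for x y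
      using that D(6)[of x y A] A u v by auto
    have no_common: "\<not> (u \<rightarrow>\<^bsub>D\<^esub> w \<and> v \<rightarrow>\<^bsub>D\<^esub> w)" for w
      using nadj uv_verts \<open>u \<noteq> v\<close> out u v unfolding competition_graph12_iff by blast
    \<comment> \<open>An arc between \<open>x\<close> and \<open>y\<close> would give a path of
      length two from \<open>u\<close> or from \<open>v\<close> to an out-neighbour of the other.
      Its middle vertex lies outside \<open>A\<close>, so it survives the deletion.\<close>
    have no_arc: "\<not> x \<rightarrow>\<^bsub>D\<^esub> y \<and> \<not> y \<rightarrow>\<^bsub>D\<^esub> x" if "u \<rightarrow>\<^bsub>D\<^esub> x" "v \<rightarrow>\<^bsub>D\<^esub> y" for x y
      using nadj uv_verts \<open>u \<noteq> v\<close> out[of u x] out[of v y] u v that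
      unfolding competition_graph12_iff by blast
    obtain x y where x: "u \<rightarrow>\<^bsub>D\<^esub> x" and y: "v \<rightarrow>\<^bsub>D\<^esub> y"
      using False uv_verts unfolding sink_iff by blast
    obtain B where B: "B \<in> P" "x \<in> B"
      using out[OF x u] D(3) by blast
    \<comment> \<open>\<open>B\<close> is the partite set of one out-neighbour \<open>x\<close> of
      \<open>u\<close>. Out-neighbours of \<open>v\<close> have no arc with \<open>x\<close>, so
      they share its partite set. Then \<open>y\<close> is in \<open>B\<close> as well, and the same
      argument with \<open>y\<close> in place of \<open>x\<close> puts all out-neighbours of
      \<open>u\<close> into \<open>B\<close>.\<close>
    have y': "y' \<in> B" if "v \<rightarrow>\<^bsub>D\<^esub> y'" for y'
      using D(7)[of x B y'] B no_arc[OF x that] out[OF that v] by blast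
    have x': "x' \<in> B" if "u \<rightarrow>\<^bsub>D\<^esub> x'" for x'
      using D(7)[of y B x'] B y'[OF y] no_arc[OF that y] out[OF that u] by blast
    have arcs: "z \<rightarrow>\<^bsub>D\<^esub> u \<or> u \<rightarrow>\<^bsub>D\<^esub> z" "z \<rightarrow>\<^bsub>D\<^esub> v \<or> v \<rightarrow>\<^bsub>D\<^esub> z" if "z \<in> verts D" "z \<notin> A" for z
      using D(7) A u v that by blast+
    have "A \<noteq> B"
      using B out[OF x u] by blast
    then have "targeted_multipartite_tournament D P A B {u, v}"
      \<comment> \<open>A vertex outside \<open>A\<close> does not receive arcs from both
        \<open>u\<close> and \<open>v\<close>, so it dominates one of them. Outside
        \<open>A \<union> B\<close> it receives neither arc and dominates both.\<close>
      using tour A B u v arcs no_common x' y' by unfold_locales blast+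
    then show ?thesis
      by blast
  qed
qed

theorem theorem3p5:
  fixes D :: "('a,'b) pre_digraph" and P :: "'a set set"
  assumes "multipartite_tournament D P"
    and "loose D P"
  shows "(\<forall>H. connected_component (competition_graph12 D) H \<longrightarrow> diameter H \<le> 2) \<and>
    ((\<not> (\<exists>v. sink D v)) \<longleftrightarrow> Digraph_Component.connected (competition_graph12 D)) \<and>
    (\<forall>S. stable_set (competition_graph12 D) S \<longrightarrow> card {A \<in> P. A \<inter> S \<noteq> {}} \<le> 2) \<and>
    card {A \<in> P. \<not> competing12 D A} \<le> 2 \<and>
    (\<forall>m. card {v. sink D v} = m \<and> parcs (competition_graph12 D) \<noteq> {} \<longrightarrow>
      domination_number (competition_graph12 D) \<in> {m + 1, m + 2})"
proof -
  obtain A B T where "targeted_multipartite_tournament D P A B T"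
    using loose_multipartite_tournament_targeted[OF assms] by blast
  then interpret targeted_multipartite_tournament D P A B T .
  show ?thesis
    using diameter_le_2_competition_graph12 connected_competition_graph12_iff
      stable_set_meets_at_most_two card_not_competing12 domination_number_bounds
    by blast
qed

end
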